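(* Let $R$ be a finite commutative ring with identity, written as a direct sum of local rings $R = R_1\oplus\cdots\oplus R_n$, where $R_i$ has unique maximal ideal $M_i$ and residue field of size $q_i = |R_i/M_i|$. Let $R^*$ denote the group of units of $R$, and for an integer $k\ge 1$ let $\sum_{i=1}^k R^* = \{x_1+\cdots+x_k : x_1,\ldots,x_k\in R^*\}$. (i) If $q_i>2$ for each $i=1,\ldots,n$, then $R^*+R^* = R$. (ii) Suppose $q_1=\cdots=q_s=2$ for some $s\ge 1$ and $q_j>2$ for each $j>s$. Then for any integer $k\ge 2$, $\sum_{i=1}^k R^*$ equals the set of $(c_1,\ldots,c_n)\in R$ such that: if $k$ is even, $c_i\in M_i$ for all $i\le s$; if $k$ is odd, $c_i\in R_i\setminus M_i$ for all $i\le s$; with $c_j\in R_j$ arbitrary for $j>s$ (if $s=n$ there are no such $j$). In particular, every element of $R$ is a sum of units of $R$ if and only if $s=1$.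
   Context: Every finite commutative ring with identity is uniquely a direct sum of finite local rings; elements of $R$ are written as tuples $(c_1,\ldots,c_n)$ with $c_i\in R_i$. *)

theory Defs
  imports "HOL-Algebra.Algebra"
begin

text \<open>Commutative rings with a unique maximal ideal. The zero ring has no maximal ideal, so it
  is not local.\<close>

definition local_ring :: "('a, 'm) ring_scheme \<Rightarrow> bool" where
  "local_ring R \<longleftrightarrow> cring R \<and> (\<exists>!M. maximalideal M R)"

definition unit_sums :: "('a, 'm) ring_scheme \<Rightarrow> nat \<Rightarrow> 'a set" where
  "unit_sums R k = {\<Oplus>\<^bsub>R\<^esub>i\<in>{1..k}. x i | x. x \<in> {1..k} \<rightarrow> Units R}"

end

theory Submission
  imports Defs
begin

text \<open>Addition and units of a direct sum are componentwise, so the set of sums of k units is a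
  product and the question is local. In a finite local ring the units are the complement of the
  maximal ideal M. If there are at least three cosets of M, then for every c some u avoids both M
  and c + M, and c = u + (c - u) is a sum of two units. If there are only two cosets, sums of
  units alternate between M and its complement; hence two such components are always in step,
  which is what prevents (0, 1, ..., 1) from being a sum of units when s > 1.\<close>

section \<open>Finite local rings\<close>

text \<open>Finiteness takes the place of Zorn's lemma: there are only finitely many proper ideals,
  so one that is maximal under inclusion lies above \<open>I\<close>.\<close>

lemma (in cring) exists_maximalideal_containing:
  assumes "finite (carrier R)" and "ideal I R" and "I \<noteq> carrier R"
  shows "\<exists>J. maximalideal J R \<and> I \<subseteq> J"
proof -
  let ?A = "{J. ideal J R \<and> J \<noteq> carrier R}"
  have sub: "J \<subseteq> carrier R" if "ideal J R" for J
    using that ideal.Icarr by fastforce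
  have "finite ?A"
    by (rule finite_subset[of _ "Pow (carrier R)"]) (use sub assms(1) in auto)
  with assms(2,3) obtain J where J: "J \<in> ?A" "I \<subseteq> J" "\<forall>K\<in>?A. J \<subseteq> K \<longrightarrow> J = K"
    using finite_has_maximal2[of ?A I] by auto
  have "maximalideal J R"
    by (rule maximalidealI) (use J in auto)
  with J(2) show ?thesis by blast
qed

text \<open>A unit in \<open>M\<close> would put 1 into \<open>M\<close>. Conversely, a non-unit
  generates a proper principal ideal; some maximal ideal contains it, and uniqueness makes that
  ideal \<open>M\<close>.\<close>

lemma local_ring_Units:
  assumes "local_ring S" and "finite (carrier S)" and "maximalideal M S"
  shows "Units S = carrier S - M"
proof -
  interpret cring S using assms(1) by (simp add: local_ring_def)
  interpret maximalideal M S by fact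
  show ?thesis
  proof (intro equalityI subsetI)
    fix x assume x: "x \<in> Units S"
    have "x \<notin> M"
    proof
      assume "x \<in> M"
      hence "\<one>\<^bsub>S\<^esub> \<in> M"
        using x I_l_closed[of x "inv\<^bsub>S\<^esub> x"] by simp
      thus False using one_imp_carrier I_notcarr by blast
    qed
    thus "x \<in> carrier S - M" using x by auto
  next
    fix x assume x: "x \<in> carrier S - M"
    show "x \<in> Units S"
    proof (rule ccontr)
      assume "x \<notin> Units S"
      hence "PIdl\<^bsub>S\<^esub> x \<noteq> carrier S"
        using x ideal_eq_carrier_iff[of x] by auto
      then obtain J where "maximalideal J S" "PIdl\<^bsub>S\<^esub> x \<subseteq> J"
        using exists_maximalideal_containing assms(2) cgenideal_ideal x by blast
      moreover from this have "J = M"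
        using assms(1,3) by (auto simp: local_ring_def)
      ultimately show False using cgenideal_self[of x] x by auto
    qed
  qed
qed

lemma (in ideal) carrier_Quot: "carrier (R Quot I) = {I +> x | x. x \<in> carrier R}"
  by (auto simp: FactRing_simps)

lemma (in ring) set_add_memI: "a \<in> A \<Longrightarrow> b \<in> B \<Longrightarrow> a \<oplus> b = x \<Longrightarrow> x \<in> A <+>\<^bsub>R\<^esub> B"
  by (auto simp: set_add_def')

lemma Units_add_Units_large_residue:
  assumes "local_ring S" and "finite (carrier S)" and "maximalideal M S"
    and "card (carrier (S Quot M)) > 2"
  shows "Units S <+>\<^bsub>S\<^esub> Units S = carrier S"
proof -
  interpret cring S using assms(1) by (simp add: local_ring_def)
  interpret maximalideal M S by fact
  note U = local_ring_Units[OF assms(1-3)]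
  have "c \<in> Units S <+>\<^bsub>S\<^esub> Units S" if c: "c \<in> carrier S" for c
  proof -
    \<comment> \<open>The cosets of 0 and \<open>c\<close>, which may coincide, make up at most two
      elements of the residue field, so a third coset exists and supplies \<open>u\<close>.\<close>
    have "\<not> carrier (S Quot M) \<subseteq> {M +>\<^bsub>S\<^esub> \<zero>\<^bsub>S\<^esub>, M +>\<^bsub>S\<^esub> c}"
      using card_mono[of "{M +>\<^bsub>S\<^esub> \<zero>\<^bsub>S\<^esub>, M +>\<^bsub>S\<^esub> c}" "carrier (S Quot M)"] assms(4)
        card_insert_le_m1[of 2 "{M +>\<^bsub>S\<^esub> c}" "M +>\<^bsub>S\<^esub> \<zero>\<^bsub>S\<^esub>"] by force
    then obtain u where u: "u \<in> carrier S" "M +>\<^bsub>S\<^esub> u \<noteq> M +>\<^bsub>S\<^esub> \<zero>\<^bsub>S\<^esub>" "M +>\<^bsub>S\<^esub> c \<noteq> M +>\<^bsub>S\<^esub> u"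
      unfolding carrier_Quot by auto
    have "u \<in> Units S" and "c \<ominus>\<^bsub>S\<^esub> u \<in> Units S"
      using quotient_eq_iff_same_a_r_cos[OF is_ideal, of u "\<zero>\<^bsub>S\<^esub>"]
        quotient_eq_iff_same_a_r_cos[OF is_ideal, of c u] u c U
      by (auto simp: a_minus_def)
    moreover have "u \<oplus>\<^bsub>S\<^esub> (c \<ominus>\<^bsub>S\<^esub> u) = c"
      using u(1) c by algebra
    ultimately show ?thesis by (rule set_add_memI)
  qed
  moreover have "Units S <+>\<^bsub>S\<^esub> Units S \<subseteq> carrier S"
    by (auto simp: set_add_def')
  ultimately show ?thesis by blast
qed

text \<open>Once the sums of k units fill the ring, this keeps them filling it for every larger k.
  The unit 1 always serves as the last summand.\<close>

lemma (in ring) carrier_add_Units: "carrier R <+>\<^bsub>R\<^esub> Units R = carrier R"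
proof -
  have "c \<in> carrier R <+>\<^bsub>R\<^esub> Units R" if c: "c \<in> carrier R" for c
  proof (rule set_add_memI)
    show "c \<ominus> \<one> \<in> carrier R" and "\<one> \<in> Units R" using c by auto
    show "c \<ominus> \<one> \<oplus> \<one> = c" using c by algebra
  qed
  thus ?thesis by (auto simp: set_add_def')
qed

text \<open>With only two cosets, the units form the single coset other than \<open>M\<close>.
  Modulo \<open>M\<close> the two equations say 1 + 1 = 0 and 0 + 1 = 1.\<close>

lemma Units_add_Units_residue_2:
  assumes "local_ring S" and "finite (carrier S)" and "maximalideal M S"
    and "card (carrier (S Quot M)) = 2"
  shows "Units S <+>\<^bsub>S\<^esub> Units S = M" and "M <+>\<^bsub>S\<^esub> Units S = carrier S - M"
proof -
  interpret cring S using assms(1) by (simp add: local_ring_def)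
  interpret maximalideal M S by fact
  note U = local_ring_Units[OF assms(1-3)]
  have one: "\<one>\<^bsub>S\<^esub> \<in> Units S" and mone: "\<ominus>\<^bsub>S\<^esub> \<one>\<^bsub>S\<^esub> \<in> Units S" by auto
  have mem: "u \<in> M" if "m \<in> M" "m \<oplus>\<^bsub>S\<^esub> u \<in> M" "u \<in> carrier S" for m u
  proof -
    have "\<ominus>\<^bsub>S\<^esub> m \<oplus>\<^bsub>S\<^esub> (m \<oplus>\<^bsub>S\<^esub> u) \<in> M"
      using that by blast
    thus ?thesis using r_neg1 that Icarr by auto
  qed
  have add: "x \<oplus>\<^bsub>S\<^esub> y \<in> M" if "x \<in> Units S" "y \<in> Units S" for x y
  proof -
    \<comment> \<open>The sum of \<open>x\<close> and \<open>y\<close> is treated as the difference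
      of \<open>x\<close> and \<open>-y\<close>. Neither of these lies in \<open>M\<close>, so they
      share the only other coset and their difference is in \<open>M\<close>.\<close>
    have xy: "x \<in> carrier S" "y \<in> carrier S" "x \<notin> M" "\<ominus>\<^bsub>S\<^esub> y \<notin> M"
      using that U a_inv_closed[of "\<ominus>\<^bsub>S\<^esub> y"] by auto
    hence "M +>\<^bsub>S\<^esub> x \<noteq> M +>\<^bsub>S\<^esub> \<zero>\<^bsub>S\<^esub>" "M +>\<^bsub>S\<^esub> (\<ominus>\<^bsub>S\<^esub> y) \<noteq> M +>\<^bsub>S\<^esub> \<zero>\<^bsub>S\<^esub>"
      using quotient_eq_iff_same_a_r_cos[OF is_ideal, of _ "\<zero>\<^bsub>S\<^esub>"] by (auto simp: a_minus_def)
    moreover have "{M +>\<^bsub>S\<^esub> x, M +>\<^bsub>S\<^esub> (\<ominus>\<^bsub>S\<^esub> y), M +>\<^bsub>S\<^esub> \<zero>\<^bsub>S\<^esub>} \<subseteq> carrier (S Quot M)"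
      using xy unfolding carrier_Quot by blast
    ultimately have "M +>\<^bsub>S\<^esub> x = M +>\<^bsub>S\<^esub> (\<ominus>\<^bsub>S\<^esub> y)"
      using assms(4) unfolding card_2_iff by auto
    hence "x \<ominus>\<^bsub>S\<^esub> (\<ominus>\<^bsub>S\<^esub> y) \<in> M"
      using quotient_eq_iff_same_a_r_cos[OF is_ideal] xy by auto
    thus ?thesis using xy by (simp add: a_minus_def)
  qed
  show "Units S <+>\<^bsub>S\<^esub> Units S = M"
  proof (intro equalityI subsetI)
    fix m assume m: "m \<in> M"
    \<comment> \<open>The decomposition is m = (m + 1) + (-1); by \<open>mem\<close>, m + 1 in
      \<open>M\<close> would force 1 into \<open>M\<close>.\<close>
    have "m \<oplus>\<^bsub>S\<^esub> \<one>\<^bsub>S\<^esub> \<in> Units S"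
      using U m one mem[of m "\<one>\<^bsub>S\<^esub>"] Icarr[OF m] by auto
    moreover have "m \<oplus>\<^bsub>S\<^esub> \<one>\<^bsub>S\<^esub> \<oplus>\<^bsub>S\<^esub> \<ominus>\<^bsub>S\<^esub> \<one>\<^bsub>S\<^esub> = m"
      using Icarr[OF m] by algebra
    ultimately show "m \<in> Units S <+>\<^bsub>S\<^esub> Units S"
      using mone set_add_memI by blast
  qed (use add in \<open>auto simp: set_add_def'\<close>)
  show "M <+>\<^bsub>S\<^esub> Units S = carrier S - M"
  proof (intro equalityI subsetI)
    fix u assume "u \<in> carrier S - M"
    thus "u \<in> M <+>\<^bsub>S\<^esub> Units S"
      using U by (intro set_add_memI[of "\<zero>\<^bsub>S\<^esub>" _ u]) auto
  next
    fix x assume "x \<in> M <+>\<^bsub>S\<^esub> Units S"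
    then obtain m u where "m \<in> M" "u \<in> Units S" "x = m \<oplus>\<^bsub>S\<^esub> u"
      by (auto simp: set_add_def')
    thus "x \<in> carrier S - M" using mem[of m u] U Icarr[of m] by auto
  qed
qed

section \<open>Sums of units\<close>

lemma (in ring) unit_sums_0: "unit_sums R 0 = {\<zero>}"
  by (auto simp: unit_sums_def)

text \<open>This replaces indexed sums by iterated sumsets, so that statements about k summands can
  be proved by induction on k.\<close>

lemma (in ring) unit_sums_Suc: "unit_sums R (Suc k) = unit_sums R k <+>\<^bsub>R\<^esub> Units R"
proof (intro equalityI subsetI)
  have S: "{1..Suc k} = insert (Suc k) {1..k}" by auto
  {
    fix y assume "y \<in> unit_sums R (Suc k)"
    then obtain x where x: "x \<in> {1..Suc k} \<rightarrow> Units R" "y = (\<Oplus>i\<in>{1..Suc k}. x i)"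
      by (auto simp: unit_sums_def)
    have "y = x (Suc k) \<oplus> (\<Oplus>i\<in>{1..k}. x i)"
      unfolding x(2) S using x(1) by (intro finsum_insert) auto
    also have "\<dots> = (\<Oplus>i\<in>{1..k}. x i) \<oplus> x (Suc k)"
      using x(1) by (intro a_comm finsum_closed) auto
    finally show "y \<in> unit_sums R k <+>\<^bsub>R\<^esub> Units R"
      by (intro set_add_memI[of "\<Oplus>i\<in>{1..k}. x i" _ "x (Suc k)"])
        (use x(1) in \<open>auto simp: unit_sums_def intro!: exI[of _ x]\<close>)
  next
    fix y assume "y \<in> unit_sums R k <+>\<^bsub>R\<^esub> Units R"
    then obtain x u where x: "x \<in> {1..k} \<rightarrow> Units R" "u \<in> Units R" "y = (\<Oplus>i\<in>{1..k}. x i) \<oplus> u"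
      by (auto simp: unit_sums_def set_add_def')
    \<comment> \<open>The new unit is stored at the index \<open>Suc k\<close>, outside {1..k}, so
      the earlier summands do not change.\<close>
    let ?x = "x(Suc k := u)"
    have "(\<Oplus>i\<in>{1..Suc k}. ?x i) = ?x (Suc k) \<oplus> (\<Oplus>i\<in>{1..k}. ?x i)"
      unfolding S using x by (intro finsum_insert) (auto simp: Pi_iff)
    also have "(\<Oplus>i\<in>{1..k}. ?x i) = (\<Oplus>i\<in>{1..k}. x i)"
      using x by (intro finsum_cong') (auto simp: Pi_iff)
    also have "?x (Suc k) \<oplus> (\<Oplus>i\<in>{1..k}. x i) = y"
      using x by (simp add: a_comm Pi_iff Units_closed)
    finally have "y = (\<Oplus>i\<in>{1..Suc k}. ?x i)" ..
    moreover have "?x \<in> {1..Suc k} \<rightarrow> Units R"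
      using x(1,2) by (auto simp: Pi_iff)
    ultimately show "y \<in> unit_sums R (Suc k)"
      unfolding unit_sums_def by blast
  }
qed

lemma (in ring) unit_sums_1: "unit_sums R 1 = Units R"
  using unit_sums_Suc[of 0] by (simp add: unit_sums_0 set_add_def' Units_closed)

text \<open>The bound k \<ge> 2 is where the sums first fill the ring: a single unit never reaches
  \<open>M\<close>.\<close>

lemma unit_sums_large_residue:
  assumes "local_ring S" and "finite (carrier S)" and "maximalideal M S"
    and "card (carrier (S Quot M)) > 2" and "k \<ge> 2"
  shows "unit_sums S k = carrier S"
proof -
  interpret cring S using assms(1) by (simp add: local_ring_def)
  show ?thesis
    using assms(5)
  proof (induction k rule: dec_induct)
    case base
    show ?case
      using unit_sums_Suc[of 1] Units_add_Units_large_residue[OF assms(1-4)]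
      by (simp add: unit_sums_1 numeral_2_eq_2 del: One_nat_def)
  qed (simp add: unit_sums_Suc carrier_add_Units)
qed

text \<open>Starting from the complement of \<open>M\<close> at k = 1, each further unit switches
  between \<open>M\<close> and its complement. The empty sum gives only 0, which need not be all of
  \<open>M\<close>.\<close>

lemma unit_sums_residue_2:
  assumes "local_ring S" and "finite (carrier S)" and "maximalideal M S"
    and "card (carrier (S Quot M)) = 2" and "k \<ge> 1"
  shows "unit_sums S k = (if even k then M else carrier S - M)"
proof -
  interpret cring S using assms(1) by (simp add: local_ring_def)
  note U = local_ring_Units[OF assms(1-3)]
  note R2 = Units_add_Units_residue_2[OF assms(1-4)]
  show ?thesis
    using assms(5)
  proof (induction k rule: dec_induct)
    case base
    show ?case using unit_sums_1 U by simp
  qed (use R2 U in \<open>auto simp: unit_sums_Suc\<close>)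
qed

section \<open>Finite direct products\<close>

text \<open>The list product is built one factor at a time, so induction on the list works: position
  0 projects to the head, and position j + 1 is position j of the tail.\<close>

lemma nth_ring_hom_RDirProd_list:
  assumes "i < length Rs"
  shows "(\<lambda>xs. xs ! i) \<in> ring_hom (RDirProd_list Rs) (Rs ! i)"
  using assms
proof (induction Rs arbitrary: i)
  case (Cons R Rs)
  let ?P = "RDirProd R (RDirProd_list Rs)"
  let ?L = "RDirProd_list (R # Rs)"
  note hom = ring_hom_memE[OF RDirProd_list_hom1[of R Rs]]
  \<comment> \<open>Transporting the operations of the binary product along (a, as) \<mapsto> a # as
    shows that they act separately on head and tail.\<close>
  have add: "(a # as) \<oplus>\<^bsub>?L\<^esub> (b # bs) = (a \<oplus>\<^bsub>R\<^esub> b) # (as \<oplus>\<^bsub>RDirProd_list Rs\<^esub> bs)"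
    and mult: "(a # as) \<otimes>\<^bsub>?L\<^esub> (b # bs) = (a \<otimes>\<^bsub>R\<^esub> b) # (as \<otimes>\<^bsub>RDirProd_list Rs\<^esub> bs)"
    if "a \<in> carrier R" "as \<in> carrier (RDirProd_list Rs)" "b \<in> carrier R"
      "bs \<in> carrier (RDirProd_list Rs)" for a as b bs
    using hom(2,3)[of "(a, as)" "(b, bs)"] that
    by (auto simp: RDirProd_carrier) (simp_all add: RDirProd_def DirProd_def monoid.defs)
  have one: "\<one>\<^bsub>?L\<^esub> = \<one>\<^bsub>R\<^esub> # \<one>\<^bsub>RDirProd_list Rs\<^esub>"
    by (simp add: RDirProd_list_one)
  note carr = RDirProd_list_carrier[of R Rs]
  show ?case
  proof (cases i)
    case 0
    show ?thesis unfolding 0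
      by (rule ring_hom_memI) (auto simp: carr add mult one)
  next
    case (Suc j)
    with Cons have "(\<lambda>xs. xs ! j) \<in> ring_hom (RDirProd_list Rs) (Rs ! j)" by simp
    note hj = ring_hom_memE[OF this]
    show ?thesis unfolding Suc
      by (rule ring_hom_memI) (auto simp: carr add mult one hj)
  qed
qed simp

text \<open>The direct sum is captured by its projections alone, which keeps the list encoding out
  of the argument. \<open>p_surj\<close> lets components be prescribed independently, and
  \<open>p_inj\<close> says that they determine the element.\<close>

locale ring_product = cring R for R :: "('a, 'm) ring_scheme" (structure) +
  fixes S :: "nat \<Rightarrow> ('b, 'l) ring_scheme" and n :: nat and p :: "nat \<Rightarrow> 'a \<Rightarrow> 'b"
  assumes cring_S: "i < n \<Longrightarrow> cring (S i)"
    and p_hom: "i < n \<Longrightarrow> p i \<in> ring_hom R (S i)"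
    and p_surj: "(\<And>i. i < n \<Longrightarrow> c i \<in> carrier (S i)) \<Longrightarrow> \<exists>x\<in>carrier R. \<forall>i<n. p i x = c i"
    and p_inj: "x \<in> carrier R \<Longrightarrow> y \<in> carrier R \<Longrightarrow> (\<And>i. i < n \<Longrightarrow> p i x = p i y) \<Longrightarrow> x = y"
begin

lemmas p_closed = ring_hom_closed[OF p_hom]
  and p_mult = ring_hom_mult[OF p_hom]
  and p_add = ring_hom_add[OF p_hom]
  and p_one = ring_hom_one[OF p_hom]

lemma p_surj_mem:
  assumes "\<And>i. i < n \<Longrightarrow> \<exists>c\<in>carrier (S i). P i c"
  obtains x where "x \<in> carrier R" "\<And>i. i < n \<Longrightarrow> P i (p i x)"
proof -
  from assms obtain c where "\<And>i. i < n \<Longrightarrow> c i \<in> carrier (S i) \<and> P i (c i)" by metis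
  with p_surj[of c] that show ?thesis by metis
qed

text \<open>The local results need finite factors, while finiteness is given for \<open>R\<close>
  only; each factor inherits it as an image of \<open>R\<close>.\<close>

lemma finite_factor:
  assumes "finite (carrier R)" and "i < n"
  shows "finite (carrier (S i))"
proof (rule finite_surj[OF assms(1)])
  show "carrier (S i) \<subseteq> p i ` carrier R"
  proof
    fix c assume c: "c \<in> carrier (S i)"
    \<comment> \<open>A preimage of \<open>c\<close> is obtained by placing \<open>c\<close> in
      component \<open>i\<close> and 0 in all others.\<close>
    obtain x where "x \<in> carrier R" "\<forall>j<n. p j x = (if j = i then c else \<zero>\<^bsub>S j\<^esub>)"
      using p_surj[of "\<lambda>j. if j = i then c else \<zero>\<^bsub>S j\<^esub>"] c cring.cring_simprules(2)[OF cring_S]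
      by metis
    thus "c \<in> p i ` carrier R" using assms(2) by (intro image_eqI[of _ _ x]) auto
  qed
qed

text \<open>Homomorphisms carry inverses to inverses. Conversely, inverses of the components are
  glued to one element \<open>y\<close>, and joint injectivity turns the componentwise identities
  into x y = 1.\<close>

lemma Units_iff: "x \<in> Units R \<longleftrightarrow> x \<in> carrier R \<and> (\<forall>i<n. p i x \<in> Units (S i))"
proof (intro iffI conjI allI impI)
  fix i assume x: "x \<in> Units R" and i: "i < n"
  then interpret Si: cring "S i" by (simp add: cring_S)
  show "p i x \<in> Units (S i)"
  proof (rule Si.unit_factor)
    have "p i x \<otimes>\<^bsub>S i\<^esub> p i (inv x) = \<one>\<^bsub>S i\<^esub>"
      using x i p_mult[of i x "inv x"] p_one by auto
    thus "p i x \<otimes>\<^bsub>S i\<^esub> p i (inv x) \<in> Units (S i)" by simp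
  qed (use x i p_closed in auto)
next
  assume x: "x \<in> carrier R \<and> (\<forall>i<n. p i x \<in> Units (S i))"
  obtain y where y: "y \<in> carrier R" "\<And>i. i < n \<Longrightarrow> p i x \<otimes>\<^bsub>S i\<^esub> p i y = \<one>\<^bsub>S i\<^esub>"
    by (rule p_surj_mem[of "\<lambda>i c. p i x \<otimes>\<^bsub>S i\<^esub> c = \<one>\<^bsub>S i\<^esub>"]) (use x in \<open>auto simp: Units_def\<close>)
  have "x \<otimes> y = \<one>"
    using x y by (intro p_inj) (auto simp: p_mult p_one)
  thus "x \<in> Units R"
    using x y(1) by (metis Units_one_closed unit_factor)
qed auto

text \<open>The summands can be chosen separately in each component and then glued. The inclusions
  in the carriers are what allows \<open>p_surj\<close> to glue them.\<close>

lemma set_add_componentwise: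
  assumes "\<And>i. i < n \<Longrightarrow> A i \<subseteq> carrier (S i)" and "\<And>i. i < n \<Longrightarrow> B i \<subseteq> carrier (S i)"
  shows "{x \<in> carrier R. \<forall>i<n. p i x \<in> A i} <+>\<^bsub>R\<^esub> {x \<in> carrier R. \<forall>i<n. p i x \<in> B i} =
    {x \<in> carrier R. \<forall>i<n. p i x \<in> A i <+>\<^bsub>S i\<^esub> B i}" (is "?A <+>\<^bsub>R\<^esub> ?B = ?C")
proof (intro equalityI subsetI)
  fix x assume "x \<in> ?A <+>\<^bsub>R\<^esub> ?B"
  thus "x \<in> ?C" using p_add by (fastforce simp: set_add_def')
next
  fix x assume x: "x \<in> ?C"
  hence "\<And>i. i < n \<Longrightarrow> \<exists>a b. a \<in> A i \<and> b \<in> B i \<and> p i x = a \<oplus>\<^bsub>S i\<^esub> b"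
    by (fastforce simp: set_add_def')
  then obtain a b where ab: "\<And>i. i < n \<Longrightarrow> a i \<in> A i \<and> b i \<in> B i \<and> p i x = a i \<oplus>\<^bsub>S i\<^esub> b i"
    by metis
  obtain y where y: "y \<in> carrier R" "\<forall>i<n. p i y = a i"
    using p_surj[of a] ab assms by blast
  obtain z where z: "z \<in> carrier R" "\<forall>i<n. p i z = b i"
    using p_surj[of b] ab assms by blast
  have "y \<oplus> z = x"
    using x y z ab by (intro p_inj) (auto simp: p_add)
  thus "x \<in> ?A <+>\<^bsub>R\<^esub> ?B"
    by (rule set_add_memI[rotated 2]) (use y z ab in auto)
qed

text \<open>Induction on k: the empty sum is 0 on both sides by joint injectivity, and adding one
  more unit is a sumset of two componentwise sets. This reduces the global question to the local
  factors.\<close>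

lemma unit_sums_componentwise:
  "unit_sums R k = {x \<in> carrier R. \<forall>i<n. p i x \<in> unit_sums (S i) k}"
proof (induction k)
  case 0
  have "p i \<zero> = \<zero>\<^bsub>S i\<^esub>" if "i < n" for i
    using that by (intro ring_hom_zero[OF p_hom]) (auto intro: cring_S cring.axioms ring_axioms)
  moreover have "unit_sums (S i) 0 = {\<zero>\<^bsub>S i\<^esub>}" if "i < n" for i
    using that by (intro ring.unit_sums_0 cring.axioms cring_S)
  ultimately show ?case by (auto simp: unit_sums_0 intro!: p_inj)
next
  case (Suc k)
  have sub: "unit_sums (S i) k \<subseteq> carrier (S i)" if "i < n" for i
  proof -
    interpret Si: cring "S i" using that by (rule cring_S)
    show ?thesis by (auto simp: unit_sums_def intro!: Si.finsum_closed)
  qed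
  have U: "Units R = {x \<in> carrier R. \<forall>i<n. p i x \<in> Units (S i)}"
    using Units_iff by blast
  have "unit_sums R (Suc k) = {x \<in> carrier R. \<forall>i<n. p i x \<in> unit_sums (S i) k <+>\<^bsub>S i\<^esub> Units (S i)}"
    unfolding unit_sums_Suc Suc.IH U
    by (rule set_add_componentwise) (use sub in \<open>auto simp: Units_def\<close>)
  thus ?case
    using ring.unit_sums_Suc[OF cring.axioms(1)[OF cring_S]] by auto
qed

end

text \<open>Surjectivity of \<open>\<phi>\<close> realizes any list of components. Lists in its
  image all have length \<open>n\<close>, so agreement at every position makes them equal, and
  injectivity of \<open>\<phi>\<close> finishes.\<close>

lemma ring_product_RDirProd_list:
  fixes Rs :: "nat \<Rightarrow> ('b, 'l) ring_scheme"
  assumes "cring R" and "\<And>i. i < n \<Longrightarrow> cring (Rs i)"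
    and "\<phi> \<in> ring_iso R (RDirProd_list (map Rs [0..<n]))"
  shows "ring_product R Rs n (\<lambda>i x. \<phi> x ! i)"
proof -
  let ?L = "RDirProd_list (map Rs [0..<n])"
  interpret cring R by fact
  note iso = ring_iso_memE[OF assms(3)]
  have hom: "\<phi> \<in> ring_hom R ?L" using assms(3) by (simp add: ring_iso_def)
  show ?thesis
  proof (intro ring_product.intro ring_product_axioms.intro)
    show "cring R" by fact
  next
    fix i assume i: "i < n"
    show "cring (Rs i)" using i by (rule assms(2))
    show "(\<lambda>x. \<phi> x ! i) \<in> ring_hom R (Rs i)"
      using ring_hom_trans[OF hom nth_ring_hom_RDirProd_list[of i]] i by (simp add: comp_def)
  next
    fix c assume c: "\<And>i. i < n \<Longrightarrow> c i \<in> carrier (Rs i)"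
    have "map c [0..<n] \<in> carrier ?L"
      using c by (intro RDirProd_list_carrier_memI) auto
    then obtain x where "x \<in> carrier R" "\<phi> x = map c [0..<n]"
      using iso(5) by (metis bij_betw_imp_surj_on imageE)
    thus "\<exists>x\<in>carrier R. \<forall>i<n. \<phi> x ! i = c i" by (intro bexI[of _ x]) auto
  next
    fix x y assume xy: "x \<in> carrier R" "y \<in> carrier R" "\<And>i. i < n \<Longrightarrow> \<phi> x ! i = \<phi> y ! i"
    have "\<phi> x = \<phi> y"
      using RDirProd_list_carrier_mem(1)[OF iso(1)] xy by (intro nth_equalityI) auto
    thus "x = y" using iso(5) xy by (auto simp: bij_betw_def dest: inj_onD)
  qed
qed

text \<open>Factors are numbered from 0, so \<open>i < s\<close> selects exactly s of them. In the
  last equivalence k \<ge> 1 leaves out the empty sum.\<close>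

theorem theorem1p2:
  fixes R :: "('a, 'm) ring_scheme"
    and Rs :: "nat \<Rightarrow> ('b, 'l) ring_scheme"
    and M :: "nat \<Rightarrow> 'b set"
    and q :: "nat \<Rightarrow> nat"
    and n :: nat
    and \<phi> :: "'a \<Rightarrow> 'b list"
  assumes "cring R" and "finite (carrier R)"
    and "\<And>i. i < n \<Longrightarrow> local_ring (Rs i)"
    and "\<And>i. i < n \<Longrightarrow> maximalideal (M i) (Rs i)"
    and "\<And>i. i < n \<Longrightarrow> q i = card (carrier (Rs i Quot M i))"
    and "\<phi> \<in> ring_iso R (RDirProd_list (map Rs [0..<n]))"
  shows "((\<forall>i<n. q i > 2) \<longrightarrow> Units R <+>\<^bsub>R\<^esub> Units R = carrier R) \<and>
    (\<forall>s. 1 \<le> s \<and> s \<le> n \<and> (\<forall>i<s. q i = 2) \<and> (\<forall>j. s \<le> j \<and> j < n \<longrightarrow> q j > 2) \<longrightarrow>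
      (\<forall>k\<ge>2. unit_sums R k =
         {x \<in> carrier R.
            (even k \<longrightarrow> (\<forall>i<s. \<phi> x ! i \<in> M i)) \<and>
            (odd k \<longrightarrow> (\<forall>i<s. \<phi> x ! i \<in> carrier (Rs i) - M i))}) \<and>
      ((\<forall>x\<in>carrier R. \<exists>k\<ge>1. x \<in> unit_sums R k) \<longleftrightarrow> s = 1))"
proof -
  have cring_Rs: "cring (Rs i)" if "i < n" for i
    using assms(3)[OF that] by (simp add: local_ring_def)
  interpret ring_product R Rs n "\<lambda>i x. \<phi> x ! i"
    by (rule ring_product_RDirProd_list) (use assms(1,6) cring_Rs in auto)
  note fin = finite_factor[OF assms(2)]
  have large: "unit_sums (Rs i) k = carrier (Rs i)" if "i < n" "q i > 2" "k \<ge> 2" for i k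
    using unit_sums_large_residue[OF assms(3) fin assms(4)] assms(5) that by simp
  \<comment> \<open>Unlike \<open>large\<close>, this holds from k = 1 on; the final equivalence
    needs that case.\<close>
  have two: "unit_sums (Rs i) k = (if even k then M i else carrier (Rs i) - M i)"
    if "i < n" "q i = 2" "k \<ge> 1" for i k
    using unit_sums_residue_2[OF assms(3) fin assms(4)] assms(5) that by simp
  have part_i: "Units R <+>\<^bsub>R\<^esub> Units R = carrier R" if q: "\<forall>i<n. q i > 2"
  proof -
    have "Units R <+>\<^bsub>R\<^esub> Units R = unit_sums R 2"
      using unit_sums_Suc[of 1] by (simp add: unit_sums_1 numeral_2_eq_2 del: One_nat_def)
    also have "\<dots> = carrier R"
      unfolding unit_sums_componentwise using q large p_closed by auto
    finally show ?thesis .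
  qed
  have part_ii: "(\<forall>k\<ge>2. unit_sums R k =
         {x \<in> carrier R.
            (even k \<longrightarrow> (\<forall>i<s. \<phi> x ! i \<in> M i)) \<and>
            (odd k \<longrightarrow> (\<forall>i<s. \<phi> x ! i \<in> carrier (Rs i) - M i))}) \<and>
      ((\<forall>x\<in>carrier R. \<exists>k\<ge>1. x \<in> unit_sums R k) \<longleftrightarrow> s = 1)"
    if s: "1 \<le> s" "s \<le> n" "\<forall>i<s. q i = 2" "\<forall>j. s \<le> j \<and> j < n \<longrightarrow> q j > 2" for s
  proof -
    have sums: "unit_sums R k =
         {x \<in> carrier R.
            (even k \<longrightarrow> (\<forall>i<s. \<phi> x ! i \<in> M i)) \<and>
            (odd k \<longrightarrow> (\<forall>i<s. \<phi> x ! i \<in> carrier (Rs i) - M i))}" if k: "k \<ge> 2" for k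
    proof -
      \<comment> \<open>Components from \<open>s\<close> on impose no condition, because k \<ge> 2
        units already fill those factors.\<close>
      have "(\<forall>i<n. \<phi> x ! i \<in> unit_sums (Rs i) k) \<longleftrightarrow>
          (\<forall>i<s. \<phi> x ! i \<in> (if even k then M i else carrier (Rs i) - M i))"
        if x: "x \<in> carrier R" for x
      proof (intro iffI allI impI)
        fix i assume i: "\<forall>i<n. \<phi> x ! i \<in> unit_sums (Rs i) k" "i < s"
        hence "\<phi> x ! i \<in> unit_sums (Rs i) k" using s by simp
        thus "\<phi> x ! i \<in> (if even k then M i else carrier (Rs i) - M i)"
          using two[of i k] s k i by simp
      next
        fix i assume i: "\<forall>i<s. \<phi> x ! i \<in> (if even k then M i else carrier (Rs i) - M i)" "i < n"
        show "\<phi> x ! i \<in> unit_sums (Rs i) k"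
          using i two[of i k] large[of i k] s k p_closed[of i x] x by (cases "i < s") auto
      qed
      thus ?thesis
        unfolding unit_sums_componentwise
        by (intro Collect_cong conj_cong refl) (cases "even k"; simp)
    qed
    have "(\<forall>x\<in>carrier R. \<exists>k\<ge>1. x \<in> unit_sums R k) \<longleftrightarrow> s = 1"
    proof
      assume "s = 1"
      show "\<forall>x\<in>carrier R. \<exists>k\<ge>1. x \<in> unit_sums R k"
      proof
        fix x assume x: "x \<in> carrier R"
        show "\<exists>k\<ge>1. x \<in> unit_sums R k"
        \<comment> \<open>Only component 0 is constrained, and it merely fixes the parity: two units
          suffice inside \<open>M 0\<close>, three outside.\<close>
        proof (cases "\<phi> x ! 0 \<in> M 0")
          case True
          hence "x \<in> unit_sums R 2" using x \<open>s = 1\<close> by (simp add: sums)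
          thus ?thesis by (intro exI[of _ 2]) auto
        next
          case False
          hence "x \<in> unit_sums R 3" using x \<open>s = 1\<close> s p_closed[of 0 x] by (simp add: sums)
          thus ?thesis by (intro exI[of _ 3]) auto
        qed
      qed
    next
      assume all: "\<forall>x\<in>carrier R. \<exists>k\<ge>1. x \<in> unit_sums R k"
      show "s = 1"
      proof (rule ccontr)
        assume "s \<noteq> 1"
        hence s2: "0 < s" "1 < s" using s(1) by auto
        \<comment> \<open>Component 0 lies in its maximal ideal and demands an even k; component 1
          is 1, outside its maximal ideal, and demands an odd k.\<close>
        let ?c = "\<lambda>i. if i = 0 then \<zero>\<^bsub>Rs i\<^esub> else \<one>\<^bsub>Rs i\<^esub>"
        have "?c i \<in> carrier (Rs i)" if "i < n" for i
          using cring.cring_simprules(2,6)[OF cring_Rs[OF that]] by (cases "i = 0") auto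
        from p_surj[of ?c, OF this] obtain x where x: "x \<in> carrier R" "\<forall>i<n. \<phi> x ! i = ?c i"
          by blast
        obtain k where k: "k \<ge> 1" "x \<in> unit_sums R k" using all x(1) by blast
        \<comment> \<open>Here k may be 1, which \<open>sums\<close> does not cover, so the
          membership is derived componentwise from \<open>two\<close>.\<close>
        have mem: "\<phi> x ! i \<in> (if even k then M i else carrier (Rs i) - M i)" if "i < s" for i
        proof -
          have i: "i < n" "q i = 2" using that s(2,3) by auto
          have "\<phi> x ! i \<in> unit_sums (Rs i) k"
            using k(2) i(1) unfolding unit_sums_componentwise by blast
          thus ?thesis by (simp only: two[OF i k(1)])
        qed
        interpret M0: maximalideal "M 0" "Rs 0" using assms(4) s s2 by auto
        interpret M1: maximalideal "M 1" "Rs 1" using assms(4) s s2 by auto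
        have "0 < n" "1 < n" using s(2) s2 by auto
        with x(2) have x01: "\<phi> x ! 0 = \<zero>\<^bsub>Rs 0\<^esub>" "\<phi> x ! 1 = \<one>\<^bsub>Rs 1\<^esub>" by simp_all
        have "\<phi> x ! 0 \<in> M 0" unfolding x01
          by (rule additive_subgroup.zero_closed[OF ideal.axioms(1)[OF M0.is_ideal]])
        moreover have "\<phi> x ! 1 \<notin> M 1"
          unfolding x01 using M1.one_imp_carrier M1.I_notcarr by blast
        ultimately show False using mem[OF s2(1)] mem[OF s2(2)] by (cases "even k") simp_all
      qed
    qed
    with sums show ?thesis by blast
  qed
  show ?thesis
    by (rule conjI, rule impI, erule part_i, intro allI impI, elim conjE, rule part_ii)
qed

end
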